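(* Let $K\subset\mathbb{R}^n$ be a polyhedral cone with normalized conic base $B_K=\{u^1,\ldots,u^p\}$ ($p\ge 1$), so that $K=\operatorname{cone}(B_K)$, and let $d:=-P_{\operatorname{aff}(B_K)}(0)$ be its circumcentric direction. Then for every $v\in\mathbb{R}^n$, $$d+v\in K^\circ \iff \max_{1\le i\le p}\langle v,u^i\rangle\le \|d\|^2,$$ $$d+v\in\operatorname{int}K^\circ \iff \max_{1\le i\le p}\langle v,u^i\rangle<\|d\|^2.$$ Moreover, the largest closed Euclidean ball centered at the origin contained in the polyhedron $\mathcal{P}:=\{v\in\mathbb{R}^n:\max_{1\le i\le p}\langle v,u^i\rangle\le\|d\|^2\}$ has radius exactly $\|d\|^2$.
   Context: $\langle\cdot,\cdot\rangle$ and $\|\cdot\|$ are the Euclidean inner product and norm on $\mathbb{R}^n$. The normalized conic base $B_K=\{u^1,\ldots,u^p\}$ of a polyhedral cone $K$ is the finite set of unit vectors along the extreme rays of $K$; $\operatorname{cone}(B_K)$ is the set of finite nonnegative linear combinations of elements of $B_K$. The polar cone is $K^\circ=\{w\in\mathbb{R}^n:\langle w,z\rangle\le 0\ \text{for all } z\in K\}$. $\operatorname{aff}(B_K)$ is the affine hull and $P_{\operatorname{aff}(B_K)}(0)$ is the orthogonal projection of the origin onto it (this is the circumcenter of $B_K$). *)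

theory Defs
  imports "HOL-Analysis.Analysis"
begin

text \<open>A ray is extreme if it is a (one-dimensional) face of the cone.\<close>

definition conic_base :: "'a::real_inner set \<Rightarrow> 'a set" where
  "conic_base K = {u. norm u = 1 \<and> conic hull {u} face_of K}"

definition polar_cone :: "'a::real_inner set \<Rightarrow> 'a set" where
  "polar_cone K = {w. \<forall>z\<in>K. w \<bullet> z \<le> 0}"

definition circumcentric_direction :: "'a::euclidean_space set \<Rightarrow> 'a" where
  "circumcentric_direction K = - closest_point (affine hull (conic_base K)) 0"

text \<open>
  A polyhedral cone with at least one extreme ray is pointed, hence generated by its
  conic base. This identity therefore need not be assumed separately.
\<close>

lemma polyhedral_cone_eq_hull_conic_base:
  fixes K :: "'a::euclidean_space set"
  assumes K: "polyhedron K" "cone K" and ne: "conic_base K \<noteq> {}"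
  shows "K = convex_cone hull (conic_base K)"
proof
  have convK: "convex K" and clK: "closed K"
    using K polyhedron_imp_convex polyhedron_imp_closed by auto
  have scale: "c *\<^sub>R x \<in> K" if "x \<in> K" "c \<ge> 0" for c x
    using K(2) that by (auto simp: cone_def)
  obtain u where u: "norm u = 1" "conic hull {u} face_of K"
    using ne by (auto simp: conic_base_def)
  have uK: "u \<in> K"
    using u(2) by (meson face_of_imp_subset hull_inc insertI1 subsetD)
  have "{0} face_of conic hull {u}"
    unfolding face_of_singleton extreme_point_of_def
  proof (intro conjI ballI notI)
    show "0 \<in> conic hull {u}" by simp
    fix p q assume "p \<in> conic hull {u}" "q \<in> conic hull {u}" and seg: "0 \<in> open_segment p q"
    then obtain c e where c: "p = c *\<^sub>R u" "c \<ge> 0" and e: "q = e *\<^sub>R u" "e \<ge> 0"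
      by (auto simp: conic_hull_explicit)
    obtain t where t: "0 < t" "t < 1" "0 = (1 - t) *\<^sub>R p + t *\<^sub>R q" and "p \<noteq> q"
      using seg by (auto simp: in_segment)
    have "((1 - t) * c + t * e) *\<^sub>R u = 0"
      using t(3) c(1) e(1) by (simp add: scaleR_left_distrib)
    then have "(1 - t) * c + t * e = 0"
      using u(1) by auto
    then have "(1 - t) * c = 0" "t * e = 0"
      using t c e by (auto simp: add_nonneg_eq_0_iff)
    then show False using t c e \<open>p \<noteq> q\<close> by auto
  qed
  then have "{0} face_of K"
    using u(2) face_of_trans by blast
  then have "{0} exposed_face_of K"
    using exposed_face_of_polyhedron K(1) by blast
  then obtain a b where ab: "K \<subseteq> {x. a \<bullet> x \<le> b}" "{0} = K \<inter> {x. a \<bullet> x = b}"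
    by (auto simp: exposed_face_of_def)
  have iff: "x = 0 \<longleftrightarrow> x \<in> K \<and> a \<bullet> x = b" for x
    using ab(2) by blast
  have b0: "b = 0" using iff[of 0] by simp
  have neg: "a \<bullet> x < 0" if "x \<in> K" "x \<noteq> 0" for x
  proof -
    have "a \<bullet> x \<le> 0" using ab(1) b0 that by auto
    moreover have "a \<bullet> x \<noteq> 0" using iff[of x] b0 that by blast
    ultimately show ?thesis by simp
  qed
  define S where "S = K \<inter> {x. a \<bullet> x = -1}"
  have convS: "convex S" unfolding S_def by (simp add: convK convex_Int convex_hyperplane)
  have clS: "closed S" unfolding S_def by (simp add: clK closed_Int closed_hyperplane)
  have "bounded S"
  proof -
    have "compact (K \<inter> sphere 0 1)" using clK by (simp add: closed_Int_compact)
    moreover have "K \<inter> sphere 0 1 \<noteq> {}" using uK u(1) by auto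
    moreover have "continuous_on (K \<inter> sphere 0 1) (\<lambda>x. a \<bullet> x)"
      by (intro continuous_intros)
    ultimately obtain m where m: "m \<in> K \<inter> sphere 0 1"
        "\<And>y. y \<in> K \<inter> sphere 0 1 \<Longrightarrow> a \<bullet> y \<le> a \<bullet> m"
      using continuous_attains_sup by metis
    have m0: "a \<bullet> m < 0" using m(1) neg by force
    have "norm x \<le> 1 / (- (a \<bullet> m))" if "x \<in> S" for x
    proof -
      have x: "x \<in> K" "a \<bullet> x = -1" using that by (auto simp: S_def)
      then have x0: "x \<noteq> 0" by auto
      have "(1 / norm x) *\<^sub>R x \<in> K \<inter> sphere 0 1"
        using scale[OF x(1)] x0 by auto
      then have "a \<bullet> ((1 / norm x) *\<^sub>R x) \<le> a \<bullet> m" by (rule m(2))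
      then have "- (1 / norm x) \<le> a \<bullet> m" using x by simp
      then show ?thesis using x0 m0 by (simp add: field_simps)
    qed
    then show ?thesis by (auto simp: bounded_iff)
  qed
  then have S: "S = convex hull {x. x extreme_point_of S}"
    using Krein_Milman_Minkowski convS clS compact_eq_bounded_closed by blast
  have ext: "v \<in> convex_cone hull (conic_base K)" if "v extreme_point_of S" for v
  proof -
    have v: "v \<in> K" "a \<bullet> v = -1" using that by (auto simp: extreme_point_of_def S_def)
    then have v0: "v \<noteq> 0" by auto
    have norml: "(1 / - (a \<bullet> p)) *\<^sub>R p \<in> S" if "p \<in> K" "p \<noteq> 0" for p
    proof -
      have "a \<bullet> p < 0" using neg that by blast
      then show ?thesis using scale[OF that(1), of "1 / - (a \<bullet> p)"] by (simp add: S_def)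
    qed
    have main: "p \<in> conic hull {v} \<and> q \<in> conic hull {v}"
      if pq: "p \<in> K" "q \<in> K" and x: "c \<ge> 0" "c *\<^sub>R v \<in> open_segment p q" for p q c
    proof -
      obtain t where t: "0 < t" "t < 1" "c *\<^sub>R v = (1 - t) *\<^sub>R p + t *\<^sub>R q" and "p \<noteq> q"
        using x(2) by (auto simp: in_segment)
      have ray: "z \<in> conic hull {v}" if "s *\<^sub>R z = r *\<^sub>R v" "s > 0" "r \<ge> 0" for s r z
      proof -
        have "(1 / s) *\<^sub>R (s *\<^sub>R z) = (1 / s) *\<^sub>R (r *\<^sub>R v)"
          by (simp only: that(1))
        then have "z = (r / s) *\<^sub>R v"
          using that(2) by (simp only: scaleR_scaleR) simp
        moreover have "r / s \<ge> 0" using that by simp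
        ultimately show ?thesis unfolding conic_hull_explicit by blast
      qed
      show ?thesis
      proof (cases "p = 0 \<or> q = 0")
        case True
        then show ?thesis
        proof
          assume "p = 0"
          then show ?thesis using t ray[of t q c] x(1) by auto
        next
          assume "q = 0"
          then show ?thesis using t ray[of "1 - t" p c] x(1) by auto
        qed
      next
        case False
        define \<alpha> where "\<alpha> = - (a \<bullet> p)"
        define \<beta> where "\<beta> = - (a \<bullet> q)"
        have pos: "\<alpha> > 0" "\<beta> > 0" using neg pq False by (auto simp: \<alpha>_def \<beta>_def)
        define p' q' where "p' = (1 / \<alpha>) *\<^sub>R p" and "q' = (1 / \<beta>) *\<^sub>R q"
        have p'q': "p' \<in> S" "q' \<in> S"
          using norml pq False by (auto simp: p'_def q'_def \<alpha>_def \<beta>_def)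
        have pp: "p = \<alpha> *\<^sub>R p'" "q = \<beta> *\<^sub>R q'" using pos by (auto simp: p'_def q'_def)
        have "a \<bullet> (c *\<^sub>R v) = (1 - t) * (a \<bullet> p) + t * (a \<bullet> q)"
          unfolding t(3) by (simp add: inner_right_distrib)
        then have c: "c = (1 - t) * \<alpha> + t * \<beta>" using v by (simp add: \<alpha>_def \<beta>_def)
        have cpos: "c > 0" unfolding c using pos t by (simp add: add_pos_pos)
        define s where "s = t * \<beta> / c"
        have "1 - s = (c - t * \<beta>) / c" using cpos by (simp add: s_def diff_divide_distrib)
        then have s1: "1 - s = (1 - t) * \<alpha> / c" using c by simp
        have "0 < 1 - s" unfolding s1 using pos(1) t(2) cpos by simp
        then have s: "0 < s" "s < 1" "1 - s = (1 - t) * \<alpha> / c"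
          using pos t(1) cpos s1 by (simp_all add: s_def)
        have "v = (1 / c) *\<^sub>R (c *\<^sub>R v)" using cpos by simp
        also have "\<dots> = (1 - s) *\<^sub>R p' + s *\<^sub>R q'"
          unfolding s(3) unfolding t(3) pp s_def by (simp add: scaleR_right_distrib)
        finally have vs: "v = (1 - s) *\<^sub>R p' + s *\<^sub>R q'" .
        have "p' = q'"
        proof (rule ccontr)
          assume "p' \<noteq> q'"
          then have "v \<in> open_segment p' q'" using vs s by (auto simp: in_segment)
          then show False using that p'q' \<open>v extreme_point_of S\<close> by (auto simp: extreme_point_of_def)
        qed
        then have "p' = v" "q' = v" using vs by (auto simp flip: scaleR_left_distrib)
        then show ?thesis using pp pos by (auto simp: conic_hull_explicit)
      qed
    qed
    have "conic hull {v} face_of K"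
      unfolding face_of_def
    proof (intro conjI ballI impI)
      show "conic hull {v} \<subseteq> K" using scale v by (auto simp: conic_hull_explicit)
      show "convex (conic hull {v})" by (simp add: convex_conic_hull)
    qed (use main in \<open>force simp: conic_hull_explicit\<close>)+
    moreover have "conic hull {(1 / norm v) *\<^sub>R v} = conic hull {v}"
      using conic_hull_image_scale[of "{v}" "\<lambda>_. 1 / norm v"] v0 by simp
    ultimately have "(1 / norm v) *\<^sub>R v \<in> conic_base K"
      using v0 by (simp add: conic_base_def)
    then have "norm v *\<^sub>R ((1 / norm v) *\<^sub>R v) \<in> convex_cone hull (conic_base K)"
      by (intro convex_cone_hull_mul hull_inc) auto
    then show ?thesis using v0 by simp
  qed
  have "S \<subseteq> convex_cone hull (conic_base K)"
    by (subst S, rule hull_minimal) (auto intro: ext convex_convex_cone_hull)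
  then show "K \<subseteq> convex_cone hull (conic_base K)"
  proof (intro subsetI)
    fix x assume "S \<subseteq> convex_cone hull (conic_base K)" "x \<in> K"
    show "x \<in> convex_cone hull (conic_base K)"
    proof (cases "x = 0")
      case False
      then have n: "a \<bullet> x < 0" using neg \<open>x \<in> K\<close> by blast
      then have "(1 / - (a \<bullet> x)) *\<^sub>R x \<in> S"
        using scale[OF \<open>x \<in> K\<close>, of "1 / - (a \<bullet> x)"] by (simp add: S_def)
      then have "(1 / - (a \<bullet> x)) *\<^sub>R x \<in> convex_cone hull (conic_base K)"
        using \<open>S \<subseteq> _\<close> by blast
      from convex_cone_hull_mul[OF this, of "- (a \<bullet> x)"]
      have "(- (a \<bullet> x)) *\<^sub>R ((1 / - (a \<bullet> x)) *\<^sub>R x) \<in> convex_cone hull (conic_base K)"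
        using n by linarith
      then show ?thesis using n by simp
    qed (simp add: convex_cone_hull_contains_0)
  qed
  show "convex_cone hull (conic_base K) \<subseteq> K"
  proof (rule hull_minimal)
    show "conic_base K \<subseteq> K"
      unfolding conic_base_def by (auto dest!: face_of_imp_subset simp: hull_inc)
    show "convex_cone K"
      using uK convK scale by (auto simp: convex_cone_def conic_def)
  qed
qed

end

theory Submission
  imports Defs
begin

text \<open>
  The circumcenter \<open>- d\<close> is orthogonal to the affine hull of the conic base, so
  \<open>d \<bullet> u i = - (norm d)\<^sup>2\<close> for every generator. Membership in the polar cone and in its interior
  need only be tested on the generators, and the largest ball is found from Cauchy-Schwarz and
  the test points \<open>r *\<^sub>R u i\<close>.
\<close>

text \<open>The obtuse-angle inequality for projection onto a closed convex set applies to
  \<open>x\<close> and also to its reflection through the closest point, which an affine set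
  contains. The two inequalities have opposite signs, which forces equality.\<close>

lemma closest_point_affine_orthogonal:
  fixes S :: "'a::euclidean_space set"
  assumes S: "affine S" and x: "x \<in> S"
  shows "(a - closest_point S a) \<bullet> (x - closest_point S a) = 0"
proof -
  let ?c = "closest_point S a"
  have cl: "convex S" "closed S"
    using S closed_affine_hull[of S] by (simp_all add: affine_imp_convex hull_same)
  have c: "?c \<in> S"
    using cl x closest_point_in_set by blast
  have "2 *\<^sub>R ?c + (- 1) *\<^sub>R x \<in> S"
    using mem_affine[OF S c x, of 2 "- 1"] by simp
  then have "(a - ?c) \<bullet> ((2 *\<^sub>R ?c + (- 1) *\<^sub>R x) - ?c) \<le> 0"
    using cl closest_point_dot by blast
  also have "(2 *\<^sub>R ?c + (- 1) *\<^sub>R x) - ?c = - (x - ?c)"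
    by (simp add: scaleR_2)
  finally have "(a - ?c) \<bullet> (x - ?c) \<ge> 0"
    unfolding inner_minus_right by simp
  moreover have "(a - ?c) \<bullet> (x - ?c) \<le> 0"
    using cl x closest_point_dot by blast
  ultimately show ?thesis
    by (rule antisym[rotated])
qed

text \<open>Projecting the origin makes \<open>0 - closest_point S 0\<close> equal to
  \<open>d\<close>, so orthogonality reads \<open>d \<bullet> (x + d) = 0\<close>.\<close>

lemma circumcentric_direction_inner:
  assumes "x \<in> conic_base K"
  shows "circumcentric_direction K \<bullet> x = - (norm (circumcentric_direction K))\<^sup>2"
  using closest_point_affine_orthogonal[OF affine_affine_hull hull_inc[OF assms], where a = 0]
  unfolding circumcentric_direction_def
  by (simp add: inner_diff_right power2_norm_eq_inner)

text \<open>A half-space through the origin is itself a convex cone, so it contains the whole hull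
  as soon as it contains \<open>B\<close>.\<close>

lemma polar_cone_convex_cone_hull:
  "polar_cone (convex_cone hull B) = {w. \<forall>b\<in>B. w \<bullet> b \<le> 0}"
proof (intro equalityI subsetI CollectI ballI)
  fix w b assume "w \<in> polar_cone (convex_cone hull B)" "b \<in> B"
  then show "w \<bullet> b \<le> 0"
    by (simp add: polar_cone_def hull_inc)
next
  fix w assume w: "w \<in> {w. \<forall>b\<in>B. w \<bullet> b \<le> 0}"
  \<comment> \<open>The witness 0 shows that the half-space is nonempty, as
    \<open>convex_cone\<close> demands.\<close>
  have "convex_cone {z. w \<bullet> z \<le> 0}"
    by (auto simp: convex_cone_def conic_def convex_halfspace_le mult_nonneg_nonpos
        intro: exI[of _ 0])
  with w have "convex_cone hull B \<subseteq> {z. w \<bullet> z \<le> 0}"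
    by (intro hull_minimal) auto
  then show "w \<in> polar_cone (convex_cone hull B)"
    by (auto simp: polar_cone_def)
qed

text \<open>Interior commutes with finite intersections, and each half-space with nonzero normal has
  the open half-space as its interior. A zero normal would break this: its weak inequality always
  holds, its strict one never.\<close>

lemma interior_halfspaces_le_0:
  fixes B :: "'a::real_inner set"
  assumes B: "finite B" "0 \<notin> B"
  shows "interior {w. \<forall>b\<in>B. w \<bullet> b \<le> 0} = {w. \<forall>b\<in>B. w \<bullet> b < 0}"
proof -
  have "{w. \<forall>b\<in>B. w \<bullet> b \<le> 0} = (\<Inter>b\<in>B. {w. b \<bullet> w \<le> 0})"
    by (auto simp: inner_commute)
  also have "interior \<dots> = (\<Inter>b\<in>B. interior {w. b \<bullet> w \<le> 0})"
    using B(1) by (induction B) simp_all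
  also have "\<dots> = {w. \<forall>b\<in>B. w \<bullet> b < 0}"
  proof -
    have "interior {w. b \<bullet> w \<le> 0} = {w. w \<bullet> b < 0}" if "b \<in> B" for b
      using interior_halfspace_le[of b 0] B(2) that by (auto simp: inner_commute)
    then show ?thesis
      by auto
  qed
  finally show ?thesis .
qed

theorem proposition3p1:
  fixes K :: "(real ^ 'n) set" and u :: "nat \<Rightarrow> real ^ 'n" and p :: nat
  assumes "polyhedron K" and "cone K"
    and "p \<ge> 1" and "conic_base K = u ` {1..p}"
  shows "let d = circumcentric_direction K;
             P = {v. (MAX i\<in>{1..p}. v \<bullet> u i) \<le> (norm d)\<^sup>2}
         in (\<forall>v. d + v \<in> polar_cone K \<longleftrightarrow> (MAX i\<in>{1..p}. v \<bullet> u i) \<le> (norm d)\<^sup>2) \<and>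
            (\<forall>v. d + v \<in> interior (polar_cone K) \<longleftrightarrow> (MAX i\<in>{1..p}. v \<bullet> u i) < (norm d)\<^sup>2) \<and>
            cball 0 ((norm d)\<^sup>2) \<subseteq> P \<and> (\<forall>r. cball 0 r \<subseteq> P \<longrightarrow> r \<le> (norm d)\<^sup>2)"
proof -
  define d where "d = circumcentric_direction K"
  have fin: "finite {1..p}" and ne: "{1..p} \<noteq> {}"
    using assms(3) by auto
  \<comment> \<open>\<open>p \<ge> 1\<close> makes the conic base nonempty, so it generates
    \<open>K\<close>.\<close>
  have K: "K = convex_cone hull (u ` {1..p})"
    using polyhedral_cone_eq_hull_conic_base[OF assms(1,2)] assms(3,4) by simp
  have unit: "norm (u i) = 1" if "i \<in> {1..p}" for i
    using assms(4) that by (auto simp: conic_base_def)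
  have du: "d \<bullet> u i = - (norm d)\<^sup>2" if "i \<in> {1..p}" for i
    unfolding d_def using assms(4) that by (intro circumcentric_direction_inner) auto
  have polar: "polar_cone K = {w. \<forall>b\<in>u ` {1..p}. w \<bullet> b \<le> 0}"
    unfolding K by (rule polar_cone_convex_cone_hull)
  have int: "interior (polar_cone K) = {w. \<forall>b\<in>u ` {1..p}. w \<bullet> b < 0}"
    unfolding polar using unit by (intro interior_halfspaces_le_0) force+
  have le: "(MAX i\<in>{1..p}. v \<bullet> u i) \<le> c \<longleftrightarrow> (\<forall>i\<in>{1..p}. v \<bullet> u i \<le> c)"
    and less: "(MAX i\<in>{1..p}. v \<bullet> u i) < c \<longleftrightarrow> (\<forall>i\<in>{1..p}. v \<bullet> u i < c)" for v c
    using fin ne by simp_all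
  \<comment> \<open>By \<open>du\<close>,
    \<open>(d + v) \<bullet> u i = v \<bullet> u i - (norm d)\<^sup>2\<close>, so the sign test on
    each generator becomes a bound on \<open>v \<bullet> u i\<close>.\<close>
  have mem: "d + v \<in> polar_cone K \<longleftrightarrow> (MAX i\<in>{1..p}. v \<bullet> u i) \<le> (norm d)\<^sup>2" for v
    unfolding le polar by (simp add: inner_add_left du)
  have mem_int: "d + v \<in> interior (polar_cone K) \<longleftrightarrow> (MAX i\<in>{1..p}. v \<bullet> u i) < (norm d)\<^sup>2" for v
    unfolding less int by (simp add: inner_add_left du)
  have ball: "cball 0 ((norm d)\<^sup>2) \<subseteq> {v. (MAX i\<in>{1..p}. v \<bullet> u i) \<le> (norm d)\<^sup>2}"
    unfolding le
  proof (intro subsetI CollectI ballI)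
    fix v :: "real ^ 'n" and i assume "v \<in> cball 0 ((norm d)\<^sup>2)" "i \<in> {1..p}"
    then show "v \<bullet> u i \<le> (norm d)\<^sup>2"
      using norm_cauchy_schwarz[of v "u i"] unit[of i] by simp
  qed
  have max: "r \<le> (norm d)\<^sup>2"
    if r: "cball 0 r \<subseteq> {v. (MAX i\<in>{1..p}. v \<bullet> u i) \<le> (norm d)\<^sup>2}" for r
  proof (cases "r \<ge> 0")
    case True
    have 1: "1 \<in> {1..p}" using assms(3) by simp
    \<comment> \<open>This boundary point of the ball attains equality in Cauchy-Schwarz: its inner
      product with \<open>u 1\<close> is exactly \<open>r\<close>.\<close>
    have "r *\<^sub>R u 1 \<in> cball 0 r"
      using True unit[OF 1] by simp
    then have "(r *\<^sub>R u 1) \<bullet> u 1 \<le> (norm d)\<^sup>2"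
      using r 1 unfolding le by blast
    then show ?thesis
      using unit[OF 1] by (simp flip: power2_norm_eq_inner)
  next
    \<comment> \<open>For negative \<open>r\<close> the ball is empty and its inclusion says
      nothing; the bound follows from the square being nonnegative.\<close>
    case False
    then show ?thesis
      using zero_le_power2[of "norm d"] by linarith
  qed
  show ?thesis
    using mem mem_int ball max by (simp only: Let_def flip: d_def) blast
qed

end
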